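(* If $\omega$ is an irreducible word, then $\Sigma_{\omega}$ is a transitive sub-shift of finite type.
   Context: $\Sigma_2=\{0,1\}^{\mathbb N}$ is the space of one-sided sequences $x=(x_i)_{i\ge 1}$, $\sigma$ is the one-sided shift, and $\prec$ is the lexicographic order on $\Sigma_2$. The mirror image of $x$ is $\bar x=(1-x_i)_{i\ge1}$, and $\overline{w_i}=1-w_i$ for symbols. For $a\in\Sigma_2$ with $a_1=1$, $\Sigma_a=\{x\in\Sigma_2\mid \bar a\prec\sigma^n(x)\prec a\text{ for every }n\ge0\}$. A word $\omega=w_1\ldots w_{\ell(\omega)}$ starting and ending with $1$, of length $\ell(\omega)$, is identified with the finite sequence $\omega 0^\infty$ in order comparisons, and $\Sigma_\omega$ means $\Sigma_{\omega0^\infty}$. For such $\omega$ put $\omega'''=w_1\ldots w_{\ell(\omega)}(\overline{w_1}\ldots\overline{w_{\ell(\omega)-1}}1)^\infty$ if $\ell(\omega)\ge2$, and $1'''=1(01)^\infty$. The word $\omega$ is irreducible if for every $k<\ell(\omega)$ with $w_k=1$ the word $\omega_k=w_1\ldots w_k$ satisfies $\omega_k'''\prec\omega$. The language $\mathcal L(\Sigma)$ of $\Sigma\subset\Sigma_2$ is the set of finite words occurring in elements of $\Sigma$. $\Sigma$ is transitive if for every ordered pair $u,v\in\mathcal L(\Sigma)$ there is $w\in\mathcal L(\Sigma)$ with $uwv\in\mathcal L(\Sigma)$. A sub-shift of finite type is a set of the form $\{x\in\Sigma_2\mid\text{no word of }\mathcal F\text{ occurs in }x\}$, where $\mathcal F$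 is a finite set of words of the same length. *)

theory Defs
  imports "HOL-Library.Stream" "HOL-Library.Fun_Lexorder"
begin

text \<open>
  The symbol \<open>0\<close> is \<^const>\<open>False\<close> and \<open>1\<close> is \<^const>\<open>True\<close>, so \<open>\<Sigma>\<^sub>2\<close> is the whole type
  \<open>bool stream\<close>, the \<open>n\<close>-th iterate of the shift is \<^term>\<open>sdrop n\<close>, and \<open>\<Sigma>\<^sub>2\<close> is ordered
  through \<open>False < True\<close>. Positions count from \<open>0\<close>: \<open>x\<^sub>i\<close> is \<open>x !! (i - 1)\<close>.
\<close>

definition lex_less :: "bool stream \<Rightarrow> bool stream \<Rightarrow> bool"  (infix "\<prec>" 50) where
  "x \<prec> y \<longleftrightarrow> less_fun (snth x) (snth y)"

definition mirror :: "bool stream \<Rightarrow> bool stream" where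
  "mirror x = smap Not x"

definition mirror_word :: "bool list \<Rightarrow> bool list" where
  "mirror_word w = map Not w"

definition Sigma_seq :: "bool stream \<Rightarrow> bool stream set" where
  "Sigma_seq a = {x. \<forall>n. mirror a \<prec> sdrop n x \<and> sdrop n x \<prec> a}"

definition pad :: "bool list \<Rightarrow> bool stream" where
  "pad w = w @- sconst False"

definition Sigma_word :: "bool list \<Rightarrow> bool stream set" where
  "Sigma_word w = Sigma_seq (pad w)"

text \<open>This is \<open>\<omega>'''\<close>; the second branch is the exceptional case \<open>1''' = 1(01)\<^sup>\<infinity>\<close> (words begin with \<open>1\<close>).\<close>

definition triple_prime :: "bool list \<Rightarrow> bool stream" where
  "triple_prime w =
     (if length w \<ge> 2 then w @- cycle (mirror_word (butlast w) @ [True])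
      else [True] @- cycle [False, True])"

definition starts_ends_with_1 :: "bool list \<Rightarrow> bool" where
  "starts_ends_with_1 w \<longleftrightarrow> w \<noteq> [] \<and> hd w = True \<and> last w = True"

definition irreducible_word :: "bool list \<Rightarrow> bool" where
  "irreducible_word w \<longleftrightarrow> starts_ends_with_1 w \<and>
     (\<forall>k. 1 \<le> k \<and> k < length w \<and> w ! (k - 1) = True \<longrightarrow> triple_prime (take k w) \<prec> pad w)"

definition occurs_in :: "bool list \<Rightarrow> bool stream \<Rightarrow> bool" where
  "occurs_in u x \<longleftrightarrow> (\<exists>n. stake (length u) (sdrop n x) = u)"

text \<open>The empty word occurs in every sequence, so it belongs to the language of every
  nonempty set.\<close>

definition language :: "bool stream set \<Rightarrow> bool list set" where
  "language S = {u. \<exists>x\<in>S. occurs_in u x}"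

definition transitive_shift :: "bool stream set \<Rightarrow> bool" where
  "transitive_shift S \<longleftrightarrow>
     (\<forall>u\<in>language S. \<forall>v\<in>language S. \<exists>w\<in>language S. u @ w @ v \<in> language S)"

text \<open>The empty set counts as a sub-shift of finite type (it arises for \<open>\<omega> = 1\<close>), and it is
  vacuously transitive.\<close>

definition subshift_of_finite_type :: "bool stream set \<Rightarrow> bool" where
  "subshift_of_finite_type S \<longleftrightarrow>
     (\<exists>F m. finite F \<and> (\<forall>u\<in>F. length u = m) \<and> S = {x. \<forall>u\<in>F. \<not> occurs_in u x})"

end

(*
  A comparison of a sequence with w0^oo, or with its mirror image, is decided within the first
  length w letters, whence finite type.

  For transitivity, every word u of the language is continued to a sequence of the subshift that
  is eventually (10)^oo. Conversely, a sequence y of the subshift may be preceded by the letter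
  different from its first one, because (10)^oo < w (irreducibility at k = 1), so alternating
  words of any length may precede y, and two sequences can be glued along such a word.

  The continuation is found by induction on the length of u. If u is neither a prefix of w nor of
  its mirror image, its first letter imposes no constraint. Otherwise let u = w_1 ... w_k, up to
  mirror images, not alternating. A continuation of w_1 ... w_(k-1) given by the induction
  hypothesis either continues with w_k, or it shows that w_1 ... w_(k-1) 0 is in the language; so
  then is its mirror image t. Now u t^N, for large N, has all its suffixes of length at least k
  strictly between mirror w and w: for u t^N itself this is irreducibility at k, and for the
  others it follows from u and t being in the language, or from irreducibility at some m < k.
  Hence only the last k - 1 letters of t constrain what follows, and the induction hypothesis applies to them.
*)

theory Submission
  imports Defs
begin

section \<open>Strict lexicographic comparison of finite words\<close>

text \<open>Strict lexicographic order decided at a position common to both words; a proper prefix is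
  not smaller, so the order is stable under appending on either side.\<close>

fun sless :: "bool list \<Rightarrow> bool list \<Rightarrow> bool" where
  "sless (a # u) (b # v) \<longleftrightarrow> a < b \<or> a = b \<and> sless u v"
| "sless _ _ \<longleftrightarrow> False"

lemma sless_append: "sless u v \<Longrightarrow> sless (u @ a) (v @ b)"
  by (induction u v rule: sless.induct) auto

lemma sless_append_left: "sless u v \<Longrightarrow> sless (u @ a) v"
  using sless_append[of u v a "[]"] by simp

lemma sless_append_right: "sless u v \<Longrightarrow> sless u (v @ b)"
  using sless_append[of u v "[]" b] by simp

lemma sless_cancel: "sless (p @ u) (p @ v) \<longleftrightarrow> sless u v"
  by (induction p) auto

lemma sless_trans: "sless u v \<Longrightarrow> sless v w \<Longrightarrow> sless u w"
proof (induction u v arbitrary: w rule: sless.induct)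
  case (1 a u b v)
  then show ?case by (cases w) auto
qed auto

lemma sless_irrefl: "\<not> sless u u"
  by (induction u) auto

lemma sless_asym: "sless u v \<Longrightarrow> \<not> sless v u"
  using sless_trans sless_irrefl by blast

lemma sless_map_Not: "sless (map Not u) (map Not v) \<longleftrightarrow> sless v u"
  by (induction u v rule: sless.induct) auto

lemma not_sless_take:
  "\<not> sless u v \<Longrightarrow> \<not> sless v u \<Longrightarrow> length u \<le> length v \<Longrightarrow> u = take (length u) v"
  by (induction u v rule: sless.induct) auto

lemma sless_take_right: "sless u (take n v) \<Longrightarrow> sless u v"
  using sless_append_right[of u "take n v" "drop n v"] by simp

lemma sless_take_left: "sless (take n u) v \<Longrightarrow> sless u v"
  using sless_append_left[of "take n u" v "drop n u"] by simp

lemma sless_take_length: "sless u v \<Longrightarrow> sless (take (length v) u) v"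
  by (induction u v rule: sless.induct) auto

lemma sless_stake_mono:
  assumes "sless (stake m x) w" shows "sless (stake (m + n) x) w"
  using sless_append_left[OF assms] by (metis stake_add)

text \<open>The deciding letter stands at a position inside \<open>w\<close>, so a window of any
  length can be cut or extended to \<open>length w\<close>.\<close>

lemma sless_stake_length:
  assumes "sless (stake m x) w" shows "sless (stake (length w) x) w"
proof -
  have "take (length w) (stake (m + length w) x) = stake (length w) x"
    by (simp add: take_stake min_def)
  then show ?thesis
    using sless_take_length[OF sless_stake_mono[OF assms, of "length w"]] by simp
qed

section \<open>Membership in the subshift through finite windows\<close>

lemma less_fun_snth_SCons:
  "less_fun (snth (a ## x)) (snth (b ## y)) \<longleftrightarrow> a < b \<or> a = b \<and> less_fun (snth x) (snth y)"
  for a b :: bool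
proof
  assume "less_fun (snth (a ## x)) (snth (b ## y))"
  then obtain k where k: "(a ## x) !! k < (b ## y) !! k"
    "\<And>k'. k' < k \<Longrightarrow> (a ## x) !! k' = (b ## y) !! k'"
    by (auto simp: less_fun_def)
  show "a < b \<or> a = b \<and> less_fun (snth x) (snth y)"
  proof (cases k)
    case 0
    with k(1) show ?thesis by simp
  next
    case (Suc i)
    have "a = b" using k(2)[of 0] Suc by simp
    moreover have "less_fun (snth x) (snth y)"
      unfolding less_fun_def
    proof (intro exI conjI allI impI)
      show "x !! i < y !! i" using k(1) Suc by simp
      show "x !! j = y !! j" if "j < i" for j using k(2)[of "Suc j"] that Suc by simp
    qed
    ultimately show ?thesis by simp
  qed
next
  assume "a < b \<or> a = b \<and> less_fun (snth x) (snth y)"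
  then show "less_fun (snth (a ## x)) (snth (b ## y))"
  proof
    assume "a < b"
    then show ?thesis unfolding less_fun_def by (intro exI[of _ 0]) auto
  next
    assume *: "a = b \<and> less_fun (snth x) (snth y)"
    then obtain k where k: "x !! k < y !! k" "\<And>k'. k' < k \<Longrightarrow> x !! k' = y !! k'"
      by (auto simp: less_fun_def)
    show ?thesis unfolding less_fun_def
    proof (intro exI[of _ "Suc k"] conjI allI impI)
      show "(a ## x) !! Suc k < (b ## y) !! Suc k" using k(1) by simp
      show "(a ## x) !! j = (b ## y) !! j" if "j < Suc k" for j
        using * k(2) that by (cases j) auto
    qed
  qed
qed

text \<open>Behind \<open>w\<close> the padding consists of zeros, and no letter is below 0; so the
  deciding position lies inside \<open>w\<close>.\<close>

lemma lex_less_pad_iff: "x \<prec> pad w \<longleftrightarrow> sless (stake (length w) x) w"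
proof (induction w arbitrary: x)
  case Nil
  show ?case by (auto simp: lex_less_def pad_def less_fun_def)
next
  case (Cons b w)
  have "x \<prec> pad (b # w) \<longleftrightarrow> less_fun (snth (shd x ## stl x)) (snth (b ## pad w))"
    by (simp add: lex_less_def pad_def)
  also have "\<dots> \<longleftrightarrow> shd x < b \<or> shd x = b \<and> stl x \<prec> pad w"
    unfolding less_fun_snth_SCons by (simp add: lex_less_def)
  finally show ?case by (simp add: Cons.IH)
qed

lemma mirror_lex_less: "mirror x \<prec> y \<longleftrightarrow> mirror y \<prec> x"
  by (auto simp: lex_less_def mirror_def less_fun_def)

text \<open>Mirroring reverses the order, so the lower bound is expressed for the mirrored word;
  both bounds then compare with \<open>w\<close>, and mirror symmetry is built in.\<close>

definition strictly_between :: "bool list \<Rightarrow> bool list \<Rightarrow> bool" where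
  "strictly_between w v \<longleftrightarrow> sless v w \<and> sless (map Not v) w"

lemma strictly_between_append: "strictly_between w v \<Longrightarrow> strictly_between w (v @ a)"
  by (simp add: strictly_between_def sless_append_left)

lemma strictly_between_map_Not [simp]: "strictly_between w (map Not v) \<longleftrightarrow> strictly_between w v"
  by (auto simp: strictly_between_def comp_def)

lemma strictly_between_stake_length:
  assumes "strictly_between w (stake m x)" shows "strictly_between w (stake (length w) x)"
  using assms sless_stake_length[of m x w] sless_stake_length[of m "smap Not x" w]
  by (simp add: strictly_between_def)

lemma Sigma_word_iff: "x \<in> Sigma_word w \<longleftrightarrow> (\<forall>n. strictly_between w (stake (length w) (sdrop n x)))"
proof -
  have "mirror (pad w) \<prec> y \<longleftrightarrow> sless (map Not (stake (length w) y)) w" for y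
    by (subst mirror_lex_less) (simp add: lex_less_pad_iff mirror_def)
  then show ?thesis
    by (auto simp: Sigma_word_def Sigma_seq_def strictly_between_def lex_less_pad_iff)
qed

section \<open>Prepending, mirroring and gluing\<close>

lemma Sigma_word_SCons:
  "b ## y \<in> Sigma_word w \<longleftrightarrow> y \<in> Sigma_word w \<and> strictly_between w (stake (length w) (b ## y))"
proof
  assume "b ## y \<in> Sigma_word w"
  then have *: "strictly_between w (stake (length w) (sdrop n (b ## y)))" for n
    by (simp add: Sigma_word_iff)
  have "strictly_between w (stake (length w) (sdrop n y))" for n using *[of "Suc n"] by simp
  moreover have "strictly_between w (stake (length w) (b ## y))" using *[of 0] by simp
  ultimately show "y \<in> Sigma_word w \<and> strictly_between w (stake (length w) (b ## y))"
    by (simp add: Sigma_word_iff)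
next
  assume *: "y \<in> Sigma_word w \<and> strictly_between w (stake (length w) (b ## y))"
  have "strictly_between w (stake (length w) (sdrop n (b ## y)))" for n
    using * by (cases n) (auto simp: Sigma_word_iff)
  then show "b ## y \<in> Sigma_word w" by (simp add: Sigma_word_iff)
qed

lemma Sigma_word_SConsI:
  assumes "x \<in> Sigma_word w" and "strictly_between w (stake m (b ## x))"
  shows "b ## x \<in> Sigma_word w"
  using assms Sigma_word_SCons strictly_between_stake_length by blast

lemma Sigma_word_suffix: "u @- y \<in> Sigma_word w \<Longrightarrow> y \<in> Sigma_word w"
  by (induction u) (auto simp: Sigma_word_SCons)

lemma Sigma_word_smap_Not: "smap Not x \<in> Sigma_word w \<longleftrightarrow> x \<in> Sigma_word w"
  by (simp add: Sigma_word_iff sdrop_smap)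

text \<open>Letters of \<open>u\<close> are prepended from right to left; each new window is decided
  inside \<open>u @ s\<close>, whatever \<open>y\<close> is.\<close>

lemma Sigma_word_shift:
  assumes "s @- y \<in> Sigma_word w" and "\<And>i. i < length u \<Longrightarrow> strictly_between w (drop i u @ s)"
  shows "u @- s @- y \<in> Sigma_word w"
  using assms(2)
proof (induction u)
  case Nil
  then show ?case using assms(1) by simp
next
  case (Cons b u)
  have "u @- s @- y \<in> Sigma_word w"
    using Cons.IH Cons.prems[of "Suc _"] by simp
  moreover have "stake (Suc (length u + length s)) (b ## u @- s @- y) = (b # u) @ s"
    by (simp add: stake_shift)
  ultimately show ?case
    using Cons.prems[of 0] Sigma_word_SConsI[of "u @- s @- y" w "Suc (length u + length s)" b]
    by simp
qed

text \<open>\<open>s\<close> fills a whole window, so no window that starts in \<open>a\<close> sees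
  what follows \<open>s\<close>.\<close>

lemma Sigma_word_glue:
  assumes "length w \<le> length s" "a @- s @- x \<in> Sigma_word w" "s @- y \<in> Sigma_word w"
  shows "a @- s @- y \<in> Sigma_word w"
  using assms(2)
proof (induction a)
  case Nil
  then show ?case using assms(3) by simp
next
  case (Cons b a)
  have "stake (length w) (b ## a @- s @- z) = take (length w) (b # a @ s)" for z
    using assms(1) by (simp add: stake_shift flip: shift.simps(2) shift_append)
  then show ?case
    using Cons by (simp add: Sigma_word_SCons)
qed

section \<open>Words of the language\<close>

definition admissible :: "bool list \<Rightarrow> bool list \<Rightarrow> bool" where
  "admissible w u \<longleftrightarrow> (\<exists>y. u @- y \<in> Sigma_word w)"

lemma language_Sigma_word: "u \<in> language (Sigma_word w) \<longleftrightarrow> admissible w u"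
proof
  assume "u \<in> language (Sigma_word w)"
  then obtain x n where x: "x \<in> Sigma_word w" "stake (length u) (sdrop n x) = u"
    by (auto simp: language_def occurs_in_def)
  have "stake n x @- sdrop n x \<in> Sigma_word w" using x by (simp add: stake_sdrop)
  then have "sdrop n x \<in> Sigma_word w" by (rule Sigma_word_suffix)
  moreover have "u @- sdrop (length u) (sdrop n x) = sdrop n x"
    using stake_sdrop[of "length u" "sdrop n x"] x by simp
  ultimately show "admissible w u" unfolding admissible_def by metis
next
  assume "admissible w u"
  then obtain y where y: "u @- y \<in> Sigma_word w" by (auto simp: admissible_def)
  moreover have "stake (length u) (sdrop 0 (u @- y)) = u" by (simp add: stake_shift)
  ultimately show "u \<in> language (Sigma_word w)" unfolding language_def occurs_in_def by blast
qed

lemma admissible_suffix: "admissible w (a @ b) \<Longrightarrow> admissible w b"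
  by (auto simp: admissible_def dest: Sigma_word_suffix)

lemma admissible_prefix: "admissible w (a @ b) \<Longrightarrow> admissible w a"
  by (auto simp: admissible_def)

lemma smap_Not_Not [simp]: "smap Not (smap Not x) = x"
  by (simp add: stream.map_comp comp_def stream.map_ident)

lemma admissible_map_Not: "admissible w (map Not u) \<longleftrightarrow> admissible w u"
proof -
  have "admissible w (map Not u)" if "admissible w u" for u
  proof -
    from that obtain y where "u @- y \<in> Sigma_word w" by (auto simp: admissible_def)
    then have "smap Not (u @- y) \<in> Sigma_word w" by (simp only: Sigma_word_smap_Not)
    then show ?thesis unfolding admissible_def by (auto simp: smap_shift)
  qed
  from this[of u] this[of "map Not u"] show ?thesis by (auto simp: comp_def)
qed

lemma admissible_not_sless:
  assumes "admissible w u" shows "\<not> sless w u"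
proof
  assume "sless w u"
  from assms obtain y where "u @- y \<in> Sigma_word w" by (auto simp: admissible_def)
  then have "strictly_between w (stake (length w) (sdrop 0 (u @- y)))" unfolding Sigma_word_iff by blast
  then have "sless (stake (length w) (u @- y)) w" by (simp add: strictly_between_def)
  then have "sless (stake (length w + length u) (u @- y)) w" by (rule sless_stake_mono)
  moreover have "sless w (stake (length w + length u) (u @- y))"
    using \<open>sless w u\<close> by (simp add: stake_shift sless_append_right)
  ultimately show False using sless_asym by blast
qed

text \<open>Neither \<open>u\<close> nor its mirror image is above \<open>w\<close>; if one of them
  is not below \<open>w\<close> either, no common position decides, and a shorter word is then a
  prefix of \<open>w\<close>. A word as long as \<open>w\<close> contains a full window, which is
  decided.\<close>

lemma admissible_cases:
  assumes "admissible w u"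
  obtains "strictly_between w u"
  | "length u < length w" "u = take (length u) w"
  | "length u < length w" "map Not u = take (length u) w"
proof (cases "length u < length w")
  case True
  have "\<not> sless w u" "\<not> sless w (map Not u)"
    using assms admissible_not_sless admissible_map_Not by blast+
  then show ?thesis
    using that True not_sless_take[of u w] not_sless_take[of "map Not u" w]
    by (auto simp: strictly_between_def)
next
  case False
  from assms obtain y where "u @- y \<in> Sigma_word w" by (auto simp: admissible_def)
  then have "strictly_between w (stake (length w) (sdrop 0 (u @- y)))" unfolding Sigma_word_iff by blast
  then have "strictly_between w (take (length w) u)" using False by (simp add: stake_shift)
  then have "strictly_between w u"
    using strictly_between_append[of w "take (length w) u" "drop (length w) u"] by simp
  then show ?thesis by (rule that)
qed

lemma admissible_snoc_True:
  assumes "admissible w (a @ [True])" "length a < length w"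
  shows "sless (a @ [False]) w"
proof -
  have less: "sless (a @ [False]) (a @ [True])" by (simp add: sless_cancel)
  have "\<not> sless w (a @ [True])" using assms admissible_not_sless by blast
  then have "sless (a @ [True]) w \<or> a @ [True] = take (length (a @ [True])) w"
    using assms not_sless_take[of "a @ [True]" w] by auto
  then show ?thesis using less sless_trans sless_take_right by metis
qed

section \<open>The alternating sequences\<close>

declare stake_siterate [simp del]

abbreviation alt :: "bool \<Rightarrow> bool stream" where
  "alt \<equiv> siterate Not"

lemma alt_unfold: "alt b = b ## alt (\<not> b)"
  by (rule siterate.code)

lemma smap_Not_alt [simp]: "smap Not (alt b) = alt (\<not> b)"
  by (simp add: smap_siterate)

lemma eq_alt_False:
  assumes "x = False ## True ## x" shows "x = alt False"
proof -
  have "shd x = False" "stl x = True ## x"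
    by (subst assms, simp)+
  then show ?thesis
    by (intro stream.coinduct[where R = "\<lambda>y z. y = x \<and> z = alt False \<or> y = True ## x \<and> z = alt True"])
      auto
qed

lemma True_cycle_eq_alt: "[True] @- cycle [False, True] = alt True"
proof -
  have "cycle [False, True] = False ## True ## cycle [False, True]"
    using cycle_decomp[of "[False, True]"] by simp
  then have "cycle [False, True] = alt False" by (rule eq_alt_False)
  then show ?thesis by (subst alt_unfold) simp
qed

definition reaches_alt :: "bool list \<Rightarrow> bool list \<Rightarrow> bool" where
  "reaches_alt w u \<longleftrightarrow> (\<exists>p b. u @- p @- alt b \<in> Sigma_word w)"

lemma reaches_alt_map_Not: "reaches_alt w (map Not u) \<Longrightarrow> reaches_alt w u"
proof -
  assume "reaches_alt w (map Not u)"
  then obtain p b where "map Not u @- p @- alt b \<in> Sigma_word w"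
    by (auto simp: reaches_alt_def)
  then have "smap Not (map Not u @- p @- alt b) \<in> Sigma_word w"
    by (simp only: Sigma_word_smap_Not)
  then have "u @- map Not p @- alt (\<not> b) \<in> Sigma_word w"
    by (simp add: smap_shift comp_def)
  then show ?thesis unfolding reaches_alt_def by blast
qed

lemma reaches_alt_snoc:
  assumes "reaches_alt w u" obtains b where "reaches_alt w (u @ [b])"
proof -
  from assms obtain p b where *: "u @- p @- alt b \<in> Sigma_word w"
    by (auto simp: reaches_alt_def)
  show ?thesis
  proof (cases p)
    case Nil
    then have "(u @ [b]) @- [] @- alt (\<not> b) \<in> Sigma_word w"
      using * by (simp flip: alt_unfold)
    then show ?thesis using that unfolding reaches_alt_def by blast
  next
    case (Cons c q)
    then have "(u @ [c]) @- q @- alt b \<in> Sigma_word w" using * by simp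
    then show ?thesis using that unfolding reaches_alt_def by blast
  qed
qed

lemma reaches_alt_admissible: "reaches_alt w u \<Longrightarrow> admissible w u"
  unfolding reaches_alt_def admissible_def by blast

text \<open>If \<open>w\<close> starts with 11, the second letter decides. If w = 10w'', then
  (10)^oo < w gives (10)^oo < w'', so w'' starts with 1 and is above every x starting with 0. If x
  starts with 1, then x < w forces x = 10x' with x' < w'', and the induction hypothesis for w''
  gives x < w''.\<close>

lemma sless_alternating_Cons:
  assumes "sless (stake n (alt True)) w" "sless (stake n x) w"
  shows "sless (stake (Suc (Suc n)) (True ## False ## x)) w"
  using assms
proof (induction w arbitrary: n x rule: length_induct)
  case (1 w)
  show ?case
  proof (cases w rule: list.exhaust[case_names Nil Cons])
    case (Cons a w')
    obtain m where n: "n = Suc m" using 1 by (cases n) auto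
    have a: "a" using 1(2) Cons n by auto
    show ?thesis
    proof (cases w' rule: list.exhaust[case_names Nil Cons])
      case Nil
      then show ?thesis using 1(2) Cons n a by auto
    next
      case w': (Cons b w'')
      show ?thesis
      proof (cases b)
        case True
        then show ?thesis using Cons w' a by simp
      next
        case False
        obtain k where m: "m = Suc k" using 1(2) Cons n w' a by (cases m) auto
        have alt: "sless (stake k (alt True)) w''"
          using 1(2) Cons w' a False n m by simp
        obtain j where k: "k = Suc j" using alt by (cases k) auto
        have "sless (stake n x) w''"
        proof (cases "shd x")
          case T: True
          then have "\<not> shd (stl x)" "sless (stake k (stl (stl x))) w''"
            using 1(3) Cons w' a False n m by auto
          moreover have "x = True ## False ## stl (stl x)"
            using T calculation by (metis (full_types) stream.collapse)
          moreover have "sless (stake (Suc (Suc k)) (True ## False ## stl (stl x))) w''"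
            using 1(1) alt calculation(2) Cons w' by simp
          ultimately show ?thesis using n m by simp
        next
          case F: False
          then show ?thesis using alt n k by (cases w'') auto
        qed
        then show ?thesis using Cons w' a False by simp
      qed
    qed
  qed (use 1 in auto)
qed

section \<open>First consequences of irreducibility\<close>

locale long_irreducible_word =
  fixes w :: "bool list"
  assumes irreducible: "irreducible_word w" and length_ge_2: "length w \<ge> 2"
begin

lemma hd_w: "w = True # tl w"
  using irreducible by (cases w) (auto simp: irreducible_word_def starts_ends_with_1_def)

lemma sless_False_w [simp]: "sless (False # u) w"
  by (subst hd_w) simp

text \<open>This is irreducibility at k = 1: the exceptional 1''' = 1(01)^oo is the alternating
  sequence.\<close>

lemma sless_alt_w: "sless (stake (length w) (alt True)) w"
proof -
  have "triple_prime (take 1 w) \<prec> pad w"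
    using irreducible length_ge_2 hd_w unfolding irreducible_word_def
    by (metis One_nat_def diff_self_eq_0 le_refl less_le_trans nth_Cons_0 one_less_numeral_iff
        semiring_norm(76))
  moreover have "triple_prime (take 1 w) = alt True"
    using length_ge_2 True_cycle_eq_alt by (simp add: triple_prime_def)
  ultimately show ?thesis by (simp add: lex_less_pad_iff)
qed

lemma not_sless_w_alt: "\<not> sless w (stake n (alt True))"
proof
  assume "sless w (stake n (alt True))"
  then have "sless w (stake (n + length w) (alt True))"
    using sless_append_right stake_add by metis
  moreover have "sless (stake (length w + n) (alt True)) w"
    using sless_stake_mono[OF sless_alt_w] .
  ultimately show False using sless_asym by (simp add: add.commute)
qed

lemma sless_triple_prime:
  assumes "2 \<le> m" "m < length w" "w ! (m - 1)"
  shows "sless (stake (length w) (take m w @- cycle (map Not (take (m - 1) w) @ [True]))) w"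
proof -
  have "triple_prime (take m w) \<prec> pad w"
    using assms irreducible by (simp add: irreducible_word_def)
  moreover have "triple_prime (take m w) = take m w @- cycle (map Not (take (m - 1) w) @ [True])"
    using assms by (simp add: triple_prime_def mirror_word_def butlast_take)
  ultimately show ?thesis by (simp add: lex_less_pad_iff)
qed

lemma alt_in_Sigma: "alt b \<in> Sigma_word w"
proof -
  have "strictly_between w (stake (length w) (alt b))" for b
  proof -
    have *: "sless (stake (length w) (alt False)) w"
      using length_ge_2 by (cases "length w") auto
    have "map Not (stake (length w) (alt b)) = stake (length w) (alt (\<not> b))"
      by (metis smap_Not_alt stake_smap)
    then show ?thesis using * sless_alt_w by (cases b) (simp_all add: strictly_between_def)
  qed
  moreover have "\<exists>c. sdrop n (alt b) = alt c" for n
    by (metis sdrop_siterate)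
  ultimately show ?thesis unfolding Sigma_word_iff by metis
qed

text \<open>The mirror image of 10z starts with 0, so only the upper bound matters; it follows from
  z < w and (10)^oo < w. The pair 01 is handled by mirroring.\<close>

lemma Sigma_SCons_Not_shd:
  assumes "y \<in> Sigma_word w" shows "(\<not> shd y) ## y \<in> Sigma_word w"
proof -
  have *: "True ## False ## z \<in> Sigma_word w" if "False ## z \<in> Sigma_word w" for z
  proof -
    have "z \<in> Sigma_word w" using that by (simp add: Sigma_word_SCons)
    then have "strictly_between w (stake (length w) (sdrop 0 z))" unfolding Sigma_word_iff by blast
    then have "sless (stake (length w) z) w" by (simp add: strictly_between_def)
    then have "sless (stake (Suc (Suc (length w))) (True ## False ## z)) w"
      by (rule sless_alternating_Cons[OF sless_alt_w])
    then have "strictly_between w (stake (Suc (Suc (length w))) (True ## False ## z))"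
      by (simp add: strictly_between_def)
    then show ?thesis using that Sigma_word_SConsI by blast
  qed
  show ?thesis
  proof (cases "shd y")
    case True
    have y: "y = True ## stl y" using True by (metis (full_types) stream.collapse)
    have "smap Not y = False ## smap Not (stl y)" by (subst y) simp
    then have "True ## smap Not y \<in> Sigma_word w"
      using *[of "smap Not (stl y)"] assms Sigma_word_smap_Not[of y] by simp
    then have "smap Not (True ## smap Not y) \<in> Sigma_word w"
      by (simp only: Sigma_word_smap_Not)
    then show ?thesis using True by simp
  next
    case False
    have "y = False ## stl y" using False by (metis (full_types) stream.collapse)
    then show ?thesis using *[of "stl y"] assms False by metis
  qed
qed

text \<open>The letter of \<open>alt b\<close> just before position \<open>n\<close> differs from
  the first letter of \<open>y\<close>, so the stretch is built leftwards, one opposite letter at a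
  time.\<close>

lemma Sigma_alt_shift:
  "y \<in> Sigma_word w \<Longrightarrow> shd y = alt b !! n \<Longrightarrow> stake n (alt b) @- y \<in> Sigma_word w"
proof (induction n arbitrary: b)
  case (Suc n)
  then have *: "stake n (alt (\<not> b)) @- y \<in> Sigma_word w" by simp
  have "shd (stake n (alt (\<not> b)) @- y) = (\<not> b)"
    using Suc.prems by (cases n) auto
  then show ?case using Sigma_SCons_Not_shd[OF *] by simp
qed simp

section \<open>Words followed by a mirrored block\<close>

text \<open>
  The block \<open>t\<close> is \<open>mirror_word (take k w)\<close> with its last letter raised. For \<open>m \<ge> 2\<close> the claim is
  irreducibility at \<open>m\<close>, since \<open>t\<close> begins with the unraised \<open>mirror_word (take m w)\<close>. For \<open>m = 1\<close>, where
  \<open>1'''\<close> is exceptional, it follows from \<open>(10)\<^sup>\<infinity> \<prec> w\<close>, which is strict within \<open>k\<close> letters by \<open>notalt\<close>.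
\<close>

lemma sless_mirror_block:
  fixes k m
  defines "t \<equiv> map Not (take (k - 1) w) @ [True]"
  assumes k: "k < length w" and notalt: "take k w \<noteq> stake k (alt True)"
    and m: "1 \<le> m" "m < k" and last: "w ! (m - 1)"
  shows "sless t (drop m w)"
proof (cases "m = 1")
  case True
  \<comment> \<open>The first k letters of (10)^oo are not above those of \<open>w\<close>, and by
    \<open>notalt\<close> they differ, so \<open>a\<close> is strictly below
    \<open>take k w\<close>.\<close>
  define a where "a = stake k (alt True)"
  obtain j where j: "k = Suc j" using m by (cases k) auto
  have "\<not> sless (take k w) a"
    using not_sless_w_alt[of k] sless_take_left unfolding a_def by blast
  have lens: "length (take k w) = k" "length a = k" using k by (simp_all add: a_def)
  have a_less: "sless a (take k w)"
  proof (rule ccontr)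
    assume "\<not> sless a (take k w)"
    with \<open>\<not> sless (take k w) a\<close> have "take k w = take k a"
      using not_sless_take[of "take k w" a] lens by simp
    then show False using notalt lens by (simp add: a_def)
  qed
  \<comment> \<open>Mirroring this comparison shows that 1 followed by the mirror image of w_1 ...
    w_j is at most \<open>a\<close>, hence strictly below \<open>take k w\<close>.\<close>
  have "\<not> sless (take j w) (stake j (alt True))"
    using not_sless_w_alt[of j] sless_take_left by blast
  then have "\<not> sless (map Not (stake j (alt True))) (map Not (take j w))"
    by (simp only: sless_map_Not not_False_eq_True)
  moreover have "map Not (stake j (alt True)) = stake j (alt False)"
    using stake_smap[of j Not "alt True"] by simp
  moreover have a_eq: "a = True # stake j (alt False)"
    by (simp add: a_def j)
  ultimately have "\<not> sless a (True # map Not (take j w))"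
    by simp
  moreover have "length (True # map Not (take j w)) = k" using k j by simp
  ultimately have "sless (True # map Not (take j w)) a \<or> True # map Not (take j w) = a"
    using not_sless_take[of "True # map Not (take j w)" a] lens(2) by fastforce
  then have "sless (True # map Not (take j w)) (take k w)"
    using a_less sless_trans by (elim disjE) (blast, simp only:)
  then have "sless (True # map Not (take j w)) w"
    by (rule sless_take_right)
  then have "sless (True # t) w"
    unfolding t_def using sless_append_left[of "True # map Not (take j w)" w "[True]"] j by simp
  then have "sless t (tl w)" by (subst (asm) hd_w) simp
  then show ?thesis using True by (simp add: drop_Suc)
next
  case False
  then have m2: "2 \<le> m" using m by simp
  \<comment> \<open>\<open>r\<close> is the period of
    \<open>triple_prime (take m w)\<close>.\<close>
  define r where "r = map Not (take (m - 1) w) @ [True]"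
  have "sless (take m w @ stake (length w - m) (cycle r)) (take m w @ drop m w)"
    using sless_triple_prime[OF m2 _ last] m k by (simp add: stake_shift r_def min_def)
  then have "sless (stake (length w - m) (cycle r)) (drop m w)"
    by (simp only: sless_cancel)
  then have 1: "sless (stake (length w - m + length r) (cycle r)) (drop m w)"
    by (rule sless_stake_mono)
  \<comment> \<open>The m-th letter of \<open>t\<close> is 0, the mirror image of w_m = 1, while
    \<open>r\<close> has the raised letter 1 there; before it they agree.\<close>
  have "take m t = map Not (take (m - 1) w) @ [False]"
  proof -
    have "take m w = take (m - 1) w @ [True]"
      using take_Suc_conv_app_nth[of "m - 1" w] m k last by simp
    moreover have "take m t = map Not (take m w)"
      unfolding t_def using m k by (auto simp: take_map min_def)
    ultimately show ?thesis by simp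
  qed
  then have "sless (take m t) r" unfolding r_def by (simp add: sless_cancel)
  then have "sless t r" by (rule sless_take_left)
  moreover have "\<exists>z. stake (length w - m + length r) (cycle r) = r @ z"
  proof -
    have "stake (length r + (length w - m)) (cycle r)
      = stake (length r) (cycle r) @ stake (length w - m) (sdrop (length r) (cycle r))"
      by (simp only: stake_add)
    moreover have "stake (length r) (cycle r) = r" by (rule stake_cycle_eq) (simp add: r_def)
    ultimately show ?thesis by (metis add.commute)
  qed
  ultimately show ?thesis using 1 sless_append_right sless_trans by metis
qed

text \<open>The mirrored word starts with \<open>map Not a @ [False]\<close>, which is below
  \<open>w\<close> because raising its last letter leaves it admissible. For the upper bound,
  \<open>a @ [True]\<close> is itself below \<open>w\<close>, or it is a prefix w_1 ... w_m with m <
  k, and \<open>sless_mirror_block\<close> compares \<open>t\<close> with the rest of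
  \<open>w\<close>.\<close>

lemma strictly_between_mirror_block:
  fixes k a
  defines "t \<equiv> map Not (take (k - 1) w) @ [True]"
  assumes k: "k < length w" and notalt: "take k w \<noteq> stake k (alt True)"
    and a: "Suc (length a) < k"
    and adm: "admissible w (a @ [True])" "admissible w (map Not a @ [True])"
  shows "strictly_between w ((a @ [True]) @ t)"
proof -
  have "sless (map Not a @ [False]) w"
    using admissible_snoc_True[OF adm(2)] a k by simp
  then have "sless (map Not ((a @ [True]) @ t)) w"
    using sless_append_left[of "map Not a @ [False]" w "map Not t"] by simp
  moreover have "sless ((a @ [True]) @ t) w"
  proof (cases "sless (a @ [True]) w")
    case True
    then show ?thesis by (rule sless_append_left)
  next
    case False
    define m where "m = Suc (length a)"
    have eq: "a @ [True] = take m w"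
      using not_sless_take[OF False admissible_not_sless[OF adm(1)]] a k by (simp add: m_def)
    have "w ! (m - 1)"
      using arg_cong[OF eq, of "\<lambda>l. l ! length a"] a k by (simp add: m_def nth_append)
    then have "sless t (drop m w)"
      unfolding t_def using sless_mirror_block[OF k notalt, of m] a by (simp add: m_def)
    then have "sless (take m w @ t) (take m w @ drop m w)" by (simp only: sless_cancel)
    then show ?thesis by (simp add: eq)
  qed
  ultimately show ?thesis by (simp add: strictly_between_def)
qed

section \<open>Continuation to an alternating tail\<close>

text \<open>Copies of the block \<open>t\<close> behind \<open>take k w\<close> decide the first
  window by irreducibility at k, and only the k - 1 letters of \<open>tl t\<close> remain to be
  continued.\<close>

lemma reaches_alt_step:
  assumes IH: "\<And>u. length u < k \<Longrightarrow> admissible w u \<Longrightarrow> reaches_alt w u"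
    and k: "1 \<le> k" "k < length w" and adm: "admissible w (take k w)"
  shows "reaches_alt w (take k w)"
proof (cases "take k w = stake k (alt True)")
  case True
  have "stake k (alt True) @- [] @- sdrop k (alt True) \<in> Sigma_word w"
    using alt_in_Sigma[of True] by (simp add: stake_sdrop del: sdrop_siterate)
  moreover obtain c where "sdrop k (alt True) = alt c" by (metis sdrop_siterate)
  ultimately show ?thesis using True unfolding reaches_alt_def by metis
next
  case notalt: False
  obtain j where j: "k = Suc j" using k by (cases k) auto
  have "j \<noteq> 0" 
  proof
    assume "j = 0"
    then have "take k w = stake k (alt True)" using j by (subst hd_w) simp
    with notalt show False ..
  qed
  define v where "v = take j w"
  have tk: "take k w = v @ [w ! j]"
    using k j by (simp add: v_def take_Suc_conv_app_nth)
  have lenv: "length v = j" using k j by (simp add: v_def)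
  have "reaches_alt w v"
    using IH[of v] lenv j adm admissible_prefix unfolding tk by simp
  then obtain b where b: "reaches_alt w (v @ [b])" by (rule reaches_alt_snoc)
  show ?thesis
  proof (cases "b = w ! j")
    case True
    then show ?thesis using b tk by simp
  next
    case False
    \<comment> \<open>Were this letter 0, then \<open>b\<close> would be 1 and
      \<open>v @ [b]\<close> would be admissible but above \<open>w\<close>.\<close>
    have "w ! j"
    proof (rule ccontr)
      assume "\<not> w ! j"
      then have "sless (take k w) (v @ [b])" using False tk by (simp add: sless_cancel)
      then have "sless w (v @ [b])" by (rule sless_take_left)
      then show False using b reaches_alt_admissible admissible_not_sless by blast
    qed
    with False tk b have tk: "take k w = v @ [True]" and vF: "reaches_alt w (v @ [False])"
      by auto
    \<comment> \<open>The mirror image of \<open>v @ [False]\<close>, hence admissible; it is also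
      the period of \<open>triple_prime (take k w)\<close>.\<close>
    define t where "t = map Not v @ [True]"
    have t_eq: "t = map Not (take (k - 1) w) @ [True]" by (simp add: t_def v_def j)
    obtain i where i: "j = Suc i" using \<open>j \<noteq> 0\<close> by (cases j) auto
    have "v = True # take i (tl w)" unfolding v_def i by (subst hd_w) simp
    then have v0: "v = True # tl v" by simp
    have adm_t: "admissible w t"
      using reaches_alt_admissible[OF vF] admissible_map_Not[of w "v @ [False]"]
      by (simp add: t_def)
    \<comment> \<open>These are the two admissibility hypotheses of
      \<open>strictly_between_mirror_block\<close>; replacing \<open>a\<close> by its mirror image
      interchanges them, so they serve suffixes of \<open>v @ [True]\<close> and of \<open>t\<close>
      alike.\<close>
    have drop_adm: "admissible w (drop i v @ [True])" "admissible w (map Not (drop i v) @ [True])"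
      if "i \<le> j" for i
    proof -
      have "v @ [True] = take i v @ drop i v @ [True]" by simp
      then show "admissible w (drop i v @ [True])"
        using adm admissible_suffix unfolding tk by metis
      have "t = map Not (take i v) @ map Not (drop i v) @ [True]"
        unfolding t_def by (simp flip: map_append)
      then show "admissible w (map Not (drop i v) @ [True])"
        using adm_t admissible_suffix by metis
    qed
    have between_t: "strictly_between w t"
    proof -
      have "sless (v @ [False]) (take k w)" unfolding tk by (simp add: sless_cancel)
      then have "sless (v @ [False]) w" by (rule sless_take_right)
      moreover have "sless t w" unfolding t_def by (subst v0) simp
      ultimately show ?thesis by (simp add: strictly_between_def t_def comp_def)
    qed
    \<comment> \<open>i = 0 is excluded: one copy of \<open>t\<close> need not decide the window at
      the first letter.\<close>
    have between_drop_v: "strictly_between w (drop i (v @ [True]) @ t)" if "1 \<le> i" "i \<le> j" for i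
      using strictly_between_mirror_block[OF k(2) notalt, of "drop i v"] drop_adm[OF that(2)] that lenv j
      by (simp add: t_eq)
    have between_drop_t: "strictly_between w (drop i t @ t)" if "i < length t" for i
    proof (cases "i = 0")
      case True
      then show ?thesis using between_t strictly_between_append by simp
    next
      case False
      then have "i \<le> j" "1 \<le> i" using that lenv by (auto simp: t_def)
      then have "strictly_between w ((map Not (drop i v) @ [True]) @ t)"
        using strictly_between_mirror_block[OF k(2) notalt, of "map Not (drop i v)"] drop_adm[of i] lenv j
        by (simp add: t_eq comp_def)
      then show ?thesis using \<open>i \<le> j\<close> lenv by (simp add: t_def drop_map)
    qed
    have t0: "t = False # tl t" unfolding t_def by (subst (1 2) v0) simp
    have "admissible w (tl t)"
      using adm_t admissible_suffix[of w "[False]" "tl t"] t0 by simp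
    then have "reaches_alt w (tl t)" using IH lenv j by (simp add: t_def)
    then obtain p c where pc: "tl t @- p @- alt c \<in> Sigma_word w"
      by (auto simp: reaches_alt_def)
    define y where "y = p @- alt c"
    \<comment> \<open>The dropped first letter can be restored because \<open>t\<close> alone
      already lies strictly between the bounds.\<close>
    have ty: "t @- y \<in> Sigma_word w"
    proof -
      have eq: "False ## tl t @- y = t @- y" by (subst (2) t0) simp
      have "strictly_between w (stake (length t) (False ## tl t @- y))"
        unfolding eq using between_t by (simp add: stake_shift)
      from Sigma_word_SConsI[OF pc[folded y_def] this] show ?thesis by (simp only: eq)
    qed
    have tn: "concat (replicate n t) @- t @- y \<in> Sigma_word w" for n
    proof (induction n)
      case (Suc n)
      show ?case
      proof (cases n)
        case 0
        then show ?thesis using Sigma_word_shift[OF ty between_drop_t] by simp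
      next
        case (Suc n')
        then have "t @- concat (replicate n' t) @- t @- y \<in> Sigma_word w"
          using Suc.IH by simp
        from Sigma_word_shift[OF this between_drop_t] show ?thesis using Suc by simp
      qed
    qed (simp add: ty)
    \<comment> \<open>As \<open>t\<close> is not empty, \<open>length w\<close> copies fill the
      first window.\<close>
    define z where "z = concat (replicate (length w) t) @- t @- y"
    obtain n where n: "length w = Suc n" using k by (cases "length w") auto
    have vz: "tl (v @ [True]) @- z \<in> Sigma_word w"
    proof -
      have "t @- concat (replicate n t) @- t @- y \<in> Sigma_word w"
        using tn[of "Suc n"] by simp
      moreover have "strictly_between w (drop i (tl (v @ [True])) @ t)" if "i < length (tl (v @ [True]))" for i
        using between_drop_v[of "Suc i"] that lenv by (simp only: drop_Suc) simp
      ultimately have "tl (v @ [True]) @- t @- concat (replicate n t) @- t @- y \<in> Sigma_word w"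
        by (rule Sigma_word_shift)
      then show ?thesis by (simp add: z_def n)
    qed
    have vT: "v @ [True] = True # tl (v @ [True])" by (subst (1 2) v0) simp
    have vz': "True ## tl (v @ [True]) @- z = take k w @- z"
      unfolding tk by (subst (2) vT) simp
    \<comment> \<open>On the first window this sequence agrees with
      \<open>triple_prime (take k w)\<close>.\<close>
    have "sless (stake (length w) (take k w @- z)) w"
    proof -
      have "w ! (k - 1)" using \<open>w ! j\<close> j by simp
      then have *: "sless (stake (length w) (take k w @- cycle t)) w"
        using sless_triple_prime[of k] k j \<open>j \<noteq> 0\<close> by (simp add: t_eq)
      have "t \<noteq> []" by (simp add: t_def)
      have c: "cycle t = concat (replicate i t) @- cycle t" for i
        by (induction i) (use cycle_decomp[OF \<open>t \<noteq> []\<close>] in auto)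
      have "length (concat (replicate i t)) = i * length t" for i
        by (induction i) auto
      then have "length w \<le> length (take k w @ concat (replicate (length w) t))"
        using \<open>t \<noteq> []\<close> by (cases t) (auto simp: trans_le_add2)
      then have "stake (length w) (take k w @- concat (replicate (length w) t) @- x)
        = take (length w) (take k w @ concat (replicate (length w) t))" for x
        by (simp only: stake_shift flip: shift_append) simp
      then have "stake (length w) (take k w @- cycle t) = stake (length w) (take k w @- z)"
        unfolding z_def by (subst c[of "length w"]) (simp only: shift_append)
      then show ?thesis using * by simp
    qed
    moreover have "sless (map Not (stake (length w) (take k w @- z))) w"
      unfolding vz'[symmetric] n by simp
    ultimately have "strictly_between w (stake (length w) (True ## tl (v @ [True]) @- z))"
      unfolding vz' by (simp add: strictly_between_def)
    from Sigma_word_SConsI[OF vz this] have "take k w @- z \<in> Sigma_word w"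
      by (simp only: vz')
    then have "take k w @- (concat (replicate (length w) t) @ t @ p) @- alt c \<in> Sigma_word w"
      by (simp add: z_def y_def)
    then show ?thesis unfolding reaches_alt_def by blast
  qed
qed

text \<open>If \<open>u\<close> itself is strictly between the bounds, its first letter can precede
  any continuation of the rest; otherwise \<open>u\<close> is a prefix of \<open>w\<close> up to
  mirroring.\<close>

lemma admissible_reaches_alt: "admissible w u \<Longrightarrow> reaches_alt w u"
proof (induction u rule: length_induct)
  case (1 u)
  then have IH: "\<And>u'. length u' < length u \<Longrightarrow> admissible w u' \<Longrightarrow> reaches_alt w u'" by blast
  show ?case
  proof (cases u)
    case Nil
    have "[] @- [] @- alt True \<in> Sigma_word w" using alt_in_Sigma by simp
    then show ?thesis using Nil unfolding reaches_alt_def by blast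
  next
    case (Cons a u')
    from "1.prems" show ?thesis
    proof (cases rule: admissible_cases)
      case 1
      have "admissible w u'" using "1.prems" admissible_suffix[of w "[a]" u'] Cons by simp
      then have "reaches_alt w u'" using IH Cons by simp
      then obtain p b where pb: "u' @- p @- alt b \<in> Sigma_word w" by (auto simp: reaches_alt_def)
      have "strictly_between w (stake (length u) (a ## u' @- p @- alt b))"
        using 1 Cons by (simp add: stake_shift)
      from Sigma_word_SConsI[OF pb this] have "u @- p @- alt b \<in> Sigma_word w"
        using Cons by simp
      then show ?thesis unfolding reaches_alt_def by blast
    next
      case 2
      then show ?thesis
        using reaches_alt_step[OF IH, of "length u"] "1.prems" Cons by fastforce
    next
      case 3
      have "admissible w (map Not u)" using "1.prems" by (simp add: admissible_map_Not)
      then have "reaches_alt w (map Not u)"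
        using reaches_alt_step[OF IH, of "length u"] 3 Cons by fastforce
      then show ?thesis by (rule reaches_alt_map_Not)
    qed
  qed
qed

section \<open>Transitivity\<close>

lemma transitive: "transitive_shift (Sigma_word w)"
  unfolding transitive_shift_def
proof (intro ballI)
  fix u v assume "u \<in> language (Sigma_word w)" "v \<in> language (Sigma_word w)"
  then have u: "admissible w u" and v: "admissible w v"
    by (simp_all only: language_Sigma_word)
  obtain p b where pb: "u @- p @- alt b \<in> Sigma_word w"
    using admissible_reaches_alt[OF u] by (auto simp: reaches_alt_def)
  obtain y where y: "v @- y \<in> Sigma_word w" using v by (auto simp: admissible_def)
  \<comment> \<open>Consecutive letters differ, so one of the lengths \<open>length w\<close> and
    \<open>Suc (length w)\<close> brings the alternation in phase with the first letter of
    \<open>v @- y\<close>.\<close>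
  have "alt b !! Suc (length w) = (\<not> alt b !! length w)"
    unfolding snth_siterate by (simp only: funpow.simps comp_apply)
  then obtain n where n: "length w \<le> n" "shd (v @- y) = alt b !! n"
    using that[of "length w"] that[of "Suc (length w)"] by fastforce
  \<comment> \<open>Both \<open>v @- y\<close> and the rest of the alternating tail may follow
    \<open>s\<close>, which is long enough for gluing.\<close>
  define s where "s = stake n (alt b)"
  have "s @- v @- y \<in> Sigma_word w" unfolding s_def by (rule Sigma_alt_shift[OF y n(2)])
  moreover have "(u @ p) @- s @- sdrop n (alt b) \<in> Sigma_word w"
    using pb by (simp add: s_def stake_sdrop del: sdrop_siterate)
  ultimately have "(u @ p) @- s @- v @- y \<in> Sigma_word w"
    using Sigma_word_glue[of w s "u @ p"] n(1) by (simp add: s_def)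
  then have "admissible w (u @ (p @ s) @ v)" unfolding admissible_def
    by (intro exI[of _ y]) simp
  moreover from this have "admissible w (p @ s)"
    using admissible_suffix[of w u "(p @ s) @ v"] admissible_prefix[of w "p @ s" v] by blast
  ultimately show "\<exists>x\<in>language (Sigma_word w). u @ x @ v \<in> language (Sigma_word w)"
    by (intro bexI[of _ "p @ s"]) (simp_all only: language_Sigma_word)
qed

end

section \<open>Finite type and conclusion\<close>

text \<open>Membership is a condition on each window of length \<open>length w\<close>, and there
  are only finitely many words of that length.\<close>

lemma Sigma_word_finite_type: "subshift_of_finite_type (Sigma_word w)"
proof -
  define F where "F = {u. length u = length w \<and> \<not> strictly_between w u}"
  have "finite F"
    by (rule finite_subset[OF _ finite_lists_length_eq[of "UNIV :: bool set" "length w"]])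
      (auto simp: F_def)
  moreover have "\<forall>u\<in>F. length u = length w" by (simp add: F_def)
  moreover have "Sigma_word w = {x. \<forall>u\<in>F. \<not> occurs_in u x}"
  proof (intro set_eqI iffI)
    fix x assume "x \<in> Sigma_word w"
    then show "x \<in> {x. \<forall>u\<in>F. \<not> occurs_in u x}"
      by (auto simp: Sigma_word_iff F_def occurs_in_def)
  next
    fix x assume x: "x \<in> {x. \<forall>u\<in>F. \<not> occurs_in u x}"
    show "x \<in> Sigma_word w"
      unfolding Sigma_word_iff
    proof (intro allI, rule ccontr)
      fix n assume "\<not> strictly_between w (stake (length w) (sdrop n x))"
      then have "stake (length w) (sdrop n x) \<in> F" by (simp add: F_def)
      moreover have "occurs_in (stake (length w) (sdrop n x)) x"
        unfolding occurs_in_def by (intro exI[of _ n]) simp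
      ultimately show False using x by blast
    qed
  qed
  ultimately show ?thesis
    unfolding subshift_of_finite_type_def by blast
qed

text \<open>Any letter or its mirror image is 1, which is not below 1.\<close>

lemma Sigma_word_True_empty: "Sigma_word [True] = {}"
proof -
  have "\<not> strictly_between [True] (stake (length [True]) (sdrop 0 x))" for x by (auto simp: strictly_between_def)
  then show ?thesis using Sigma_word_iff[of _ "[True]"] by blast
qed

theorem theorem4p6:
  fixes \<omega> :: "bool list"
  assumes "irreducible_word \<omega>"
  shows "transitive_shift (Sigma_word \<omega>) \<and> subshift_of_finite_type (Sigma_word \<omega>)"
proof
  show "subshift_of_finite_type (Sigma_word \<omega>)" by (rule Sigma_word_finite_type)
  show "transitive_shift (Sigma_word \<omega>)"
  proof (cases "length \<omega> \<ge> 2")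
    case True
    with assms interpret long_irreducible_word \<omega> by unfold_locales
    show ?thesis by (rule transitive)
  next
    case False
    then have "\<omega> = [True]"
      using assms
      by (cases \<omega>) (auto simp: irreducible_word_def starts_ends_with_1_def not_less_eq_eq)
    then show ?thesis
      by (simp add: Sigma_word_True_empty transitive_shift_def language_def)
  qed
qed

end
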